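(* For every $n\ge0$ and all $\alpha,\beta\in\{0,\dots,n\}$, the operators $X_\alpha(z)=X^{(n)}_\alpha(z)\in\mathrm{End}(F^{\otimes n(n-1)/2})$ satisfy \[ X_\alpha(y)X_\beta(x)=\sum_{\gamma,\delta=0}^nR(y/x)^{\beta,\alpha}_{\gamma,\delta}\,X_\gamma(x)X_\delta(y). \]
   Context: $R$ matrix (indices in $\{0,\dots,n\}$): $R(z)^{\alpha,\alpha}_{\alpha,\alpha}=1$; for $\alpha\ne\beta$, $R(z)^{\alpha,\beta}_{\alpha,\beta}=\frac{(1-z)t^{\theta(\alpha<\beta)}}{1-tz}$, $R(z)^{\beta,\alpha}_{\alpha,\beta}=\frac{(1-t)z^{\theta(\alpha>\beta)}}{1-tz}$; all other entries $0$; $\theta(\text{true})=1,\theta(\text{false})=0$. Oscillators: $F=\bigoplus_{d\ge0}\mathbb{Q}(t)|d\rangle$, $\mathbf{a}^+|d\rangle=|d+1\rangle$, $\mathbf{a}^-|d\rangle=(1-t^d)|d-1\rangle$ ($|-1\rangle=0$), $\mathbf{k}|d\rangle=t^d|d\rangle$; on $F^{\otimes N}$, $\mathbf{a}^\pm_r,\mathbf{k}_r$ act on the $r$-th factor; $\mathbf{a}^+_0:=1$. Operators $X^{(n)}_\alpha(z)$: put $N_n=n(n-1)/2$. For $n\ge1$, $0\le i\le n-1$, $0\le\alpha\le n$, let $T^{(n)}(z)_{i\alpha}$ (operators on the first $n-1$ factors) be: $T^{(n)}(z)_{i0}=\mathbf{a}^+_i$; for $\alpha\ge1$: $z\,\mathbf{k}_\alpha\cdots\mathbf{k}_{n-1}$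 if $\alpha=i+1$; $z\,\mathbf{a}^+_i\mathbf{a}^-_{\alpha-1}\mathbf{k}_\alpha\cdots\mathbf{k}_{n-1}$ if $\alpha\ge i+2$; $0$ if $\alpha\le i$ (empty products are $1$). Set $X^{(0)}_0(z)=1$ and, for $n\ge1$, $X^{(n)}_\alpha(z)=\sum_{i=0}^{n-1}\widetilde X^{(n-1)}_i(z)\,T^{(n)}(z)_{i\alpha}$ on $F^{\otimes N_n}$, where $T^{(n)}(z)_{i\alpha}$ acts on factors $1,\dots,n-1$ and $\widetilde X^{(n-1)}_i(z)$ is $X^{(n-1)}_i(z)$ acting on factors $n,\dots,N_n$ (its $r$-th factor placed at position $r+n-1$). In particular $X^{(1)}_0(z)=1$, $X^{(1)}_1(z)=z$, and for $n=2$: $X_0=1+z\mathbf{a}^+$, $X_1=z\mathbf{k}$, $X_2=z\mathbf{a}^-+z^2$. *)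

theory Defs
  imports Main
begin

text \<open>Vectors of the Fock space tensor power: coefficient functions on occupation
  lists (basis vector |d_1,...,d_N> is the list [d_1,...,d_N]); positions are 0-indexed.\<close>
type_synonym 'a fvec = "nat list \<Rightarrow> 'a"

definition basis :: "nat list \<Rightarrow> 'a::zero_neq_one fvec" where
  "basis d = (\<lambda>e. if e = d then 1 else 0)"

definition vsmul :: "'a::times \<Rightarrow> 'a fvec \<Rightarrow> 'a fvec" where
  "vsmul c v = (\<lambda>e. c * v e)"

text \<open>a^+ on position r: a^+|e> = |e+1>.\<close>
definition aplus :: "nat \<Rightarrow> 'a::zero fvec \<Rightarrow> 'a fvec" where
  "aplus r v = (\<lambda>d. if 0 < d ! r then v (d[r := d ! r - 1]) else 0)"

text \<open>a^- on position r: a^-|e> = (1 - t^e)|e-1>.\<close>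
definition aminus :: "'a::comm_ring_1 \<Rightarrow> nat \<Rightarrow> 'a fvec \<Rightarrow> 'a fvec" where
  "aminus t r v = (\<lambda>d. (1 - t ^ Suc (d ! r)) * v (d[r := Suc (d ! r)]))"

definition kop :: "'a::comm_ring_1 \<Rightarrow> nat \<Rightarrow> 'a fvec \<Rightarrow> 'a fvec" where
  "kop t r v = (\<lambda>d. t ^ (d ! r) * v d)"

text \<open>Factor r (1-indexed, r = 1..n-1) of the T-block sits at position off + r - 1.\<close>
definition kprod :: "'a::comm_ring_1 \<Rightarrow> nat \<Rightarrow> nat \<Rightarrow> nat \<Rightarrow> 'a fvec \<Rightarrow> 'a fvec" where
  "kprod t off a b = foldr (\<lambda>r f. kop t (off + r - 1) \<circ> f) [a..<b] id"

definition apos :: "nat \<Rightarrow> nat \<Rightarrow> 'a::zero fvec \<Rightarrow> 'a fvec" where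
  "apos off i = (if i = 0 then id else aplus (off + i - 1))"

text \<open>T^(n)(z)_{i alpha}, acting on factors 1..n-1 placed at positions off..off+n-2.\<close>
definition Top :: "'a::comm_ring_1 \<Rightarrow> nat \<Rightarrow> nat \<Rightarrow> nat \<Rightarrow> nat \<Rightarrow> 'a \<Rightarrow> 'a fvec \<Rightarrow> 'a fvec" where
  "Top t n off i \<alpha> z =
     (if \<alpha> = 0 then apos off i
      else if \<alpha> = i + 1 then vsmul z \<circ> kprod t off \<alpha> n
      else if i + 2 \<le> \<alpha> then vsmul z \<circ> apos off i \<circ> aminus t (off + \<alpha> - 2) \<circ> kprod t off \<alpha> n
      else (\<lambda>v e. 0))"

text \<open>Xop t n off alpha z = X^(n)_alpha(z) acting on positions off..off+N_n-1.
  X^(n)_alpha = sum_i Xtilde^(n-1)_i T^(n)_{i alpha}, with Xtilde placed at offset off+n-1.\<close>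
fun Xop :: "'a::comm_ring_1 \<Rightarrow> nat \<Rightarrow> nat \<Rightarrow> nat \<Rightarrow> 'a \<Rightarrow> 'a fvec \<Rightarrow> 'a fvec" where
  "Xop t 0 off \<alpha> z = (if \<alpha> = 0 then id else (\<lambda>v e. 0))"
| "Xop t (Suc m) off \<alpha> z =
     (\<lambda>v e. \<Sum>i<Suc m. Xop t m (off + m) i z (Top t (Suc m) off i \<alpha> z v) e)"

text \<open>R(z)^{c,d}_{a,b}: upper indices c d, lower indices a b.\<close>
definition Rm :: "'a::field \<Rightarrow> 'a \<Rightarrow> nat \<Rightarrow> nat \<Rightarrow> nat \<Rightarrow> nat \<Rightarrow> 'a" where
  "Rm t z c d a b =
     (if a = b then (if c = a \<and> d = a then 1 else 0)
      else if c = a \<and> d = b then (1 - z) * t ^ (if a < b then 1 else 0) / (1 - t * z)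
      else if c = b \<and> d = a then (1 - t) * z ^ (if a > b then 1 else 0) / (1 - t * z)
      else 0)"

end

theory Submission
  imports Defs "HOL-Computational_Algebra.Polynomial"
begin

text \<open>
  The recursion \<open>X\<^sup>(\<^sup>n\<^sup>) = X\<^sup>(\<^sup>n\<^sup>-\<^sup>1\<^sup>) T\<^sup>(\<^sup>n\<^sup>)\<close> reduces the exchange relation, by induction on \<open>n\<close>, to an
  RTT relation between the \<open>R\<close> matrices of ranks \<open>n - 1\<close> and \<open>n\<close>: \<open>T\<close> acts on other tensor factors
  than \<open>X\<^sup>(\<^sup>n\<^sup>-\<^sup>1\<^sup>)\<close>, so the two commute. On a basis vector, \<open>T\<^sub>i\<^sub>a\<close> raises the occupation number of
  factor \<open>i\<close>, lowers that of factor \<open>a - 1\<close> and multiplies by a difference of two of the weights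
  \<open>s a = t ^ (d a + \<dots> + d (n - 1))\<close>. Since \<open>R\<close> only permutes its indices, all terms of the RTT
  relation are multiples of the same basis vector, and the relation becomes an identity between
  scalars, which holds for arbitrary weights \<open>s\<close> and is a matter of the relative order of the indices.
\<close>

subsection \<open>Matrix elements of \<open>T\<close>\<close>

definition zfac :: "nat \<Rightarrow> 'a::one \<Rightarrow> 'a" where
  "zfac a z = (if a = 0 then 1 else z)"

text \<open>The weight \<open>s a\<close> is the eigenvalue of the product of \<open>k\<close>'s
  from factor \<open>a\<close> on. Multiplied by the annihilation factor \<open>1 - t ^ d\<close> of
  factor \<open>a - 1\<close>, it becomes \<open>s a - s (a - 1)\<close>, so matrix elements are
  linear in the weights. Weights are read only at indices \<ge> 1.\<close>

definition tcoef :: "(nat \<Rightarrow> 'a::comm_ring_1) \<Rightarrow> nat \<Rightarrow> nat \<Rightarrow> 'a" where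
  "tcoef s i a = (if a = 0 then 1 else if a \<le> i then 0 else if a = Suc i then s a else s a - s (a - 1))"

text \<open>The weights after an action of \<open>T\<^sub>j\<^sub>b\<close>, for \<open>t \<noteq> 0\<close>.\<close>
definition shift_tail :: "'a::field \<Rightarrow> nat \<Rightarrow> nat \<Rightarrow> (nat \<Rightarrow> 'a) \<Rightarrow> nat \<Rightarrow> 'a" where
  "shift_tail t j b s a = (if a \<le> j then t else 1) * s a / (if a < b then t else 1)"

text \<open>The difference of the two sides of the RTT relation, multiplied by \<open>x - t * y\<close> to clear the
  denominators of \<open>R(y/x)\<close>. In \<open>g i a j b\<close> the operator \<open>T\<^sub>j\<^sub>b\<close> acts first.\<close>
definition rtt_defect ::
  "'a::comm_ring_1 \<Rightarrow> 'a \<Rightarrow> 'a \<Rightarrow> (nat \<Rightarrow> nat \<Rightarrow> nat \<Rightarrow> nat \<Rightarrow> 'a) \<Rightarrow> nat \<Rightarrow> nat \<Rightarrow> nat \<Rightarrow> nat \<Rightarrow> 'a"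
  where
  "rtt_defect t x y g k l a b =
    (if k = l then (x - t * y) * (zfac a y * zfac b x * g k a l b)
     else (x - y) * (if k < l then t else 1) * (zfac a y * zfac b x * g l a k b)
       + (1 - t) * (if l < k then y else x) * (zfac a y * zfac b x * g k a l b))
    - (if a = b then (x - t * y) * (zfac a x * zfac b y * g k a l b)
       else (x - y) * (if b < a then t else 1) * (zfac b x * zfac a y * g k b l a)
         + (1 - t) * (if b < a then y else x) * (zfac a x * zfac b y * g k a l b))"

text \<open>For a column written as a successor, the comparisons in \<open>tcoef\<close> and
  \<open>shift_tail\<close> are settled by how its predecessor lies relative to the rows and to the
  other column's predecessor.\<close>

lemma tcoef_0: "tcoef s i 0 = 1"
  and tcoef_Suc: "tcoef s i (Suc a) = (if a < i then 0 else if a = i then s (Suc a) else s (Suc a) - s a)"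
  by (auto simp: tcoef_def)

lemmas rtt_simps = rtt_defect_def zfac_def tcoef_0 tcoef_Suc shift_tail_def

lemma order_pos_cases:
  fixes k l p :: nat
  obtains "p < k" | "p = k" | "k < p" "p < l" | "k < p" "p = l" | "k < p" "l < p"
  by linarith

text \<open>Once the relative order of rows and columns is fixed, all conditionals disappear and a
  rational identity in \<open>t\<close>, \<open>x\<close>, \<open>y\<close> and a few free weights
  remains. Column 0 is split off because its coefficient is the constant 1.\<close>

lemma rtt_defect_shift_tail:
  fixes t x y :: "'a::field"
  assumes t: "t \<noteq> 0"
  shows "rtt_defect t x y (\<lambda>i a j b. tcoef s j b * tcoef (shift_tail t j b s) i a) k l a b = 0"
    (is "?D k l a b = 0")
proof -
  have zero_zero: "?D k l 0 0 = 0"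
    by (cases k l rule: linorder_cases) (use t in \<open>simp_all add: rtt_simps field_simps\<close>)
  have Suc_zero: "?D k l (Suc a) 0 = 0" for a
    apply (cases k l rule: linorder_cases; cases a k rule: linorder_cases; cases a l rule: linorder_cases)
    using t apply (simp_all add: rtt_simps)
    apply (simp_all add: field_simps)
    done
  have zero_Suc: "?D k l 0 (Suc b) = 0" for b
    apply (cases k l rule: linorder_cases; cases b k rule: linorder_cases; cases b l rule: linorder_cases)
    using t apply (simp_all add: rtt_simps)
    apply (simp_all add: field_simps)
    done
  have eq: "?D k k (Suc a) (Suc b) = 0" for k a b
    apply (cases a b rule: linorder_cases; cases b k rule: linorder_cases; cases a k rule: linorder_cases)
    using t apply (simp_all add: rtt_simps)
    apply (simp_all add: field_simps)
    done
  \<comment> \<open>\<open>R\<close> treats \<open>k < l\<close> and \<open>l < k\<close>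
    differently, so the two orders are checked separately, each over all positions of
    \<open>a\<close> and \<open>b\<close>.\<close>
  have less: "?D k l (Suc a) (Suc b) = 0" if "k < l" for k l a b
    apply (cases a b rule: linorder_cases; rule order_pos_cases[where p=a and k=k and l=l];
        rule order_pos_cases[where p=b and k=k and l=l])
    using t that apply (simp_all add: rtt_simps)
    apply (simp_all add: field_simps)
    done
  have greater: "?D k l (Suc a) (Suc b) = 0" if "l < k" for k l a b
    apply (cases a b rule: linorder_cases; rule order_pos_cases[where p=a and k=l and l=k];
        rule order_pos_cases[where p=b and k=l and l=k])
    using t that apply (simp_all add: rtt_simps)
    apply (simp_all add: field_simps)
    done
  have "?D k l (Suc a) (Suc b) = 0" for a b
    using eq less greater by (cases k l rule: linorder_cases) auto
  with zero_zero Suc_zero zero_Suc show ?thesis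
    by (cases a; cases b) auto
qed

section \<open>Weights and shifts of occupation numbers\<close>

definition tail :: "'a::comm_ring_1 \<Rightarrow> nat \<Rightarrow> nat \<Rightarrow> (nat \<Rightarrow> int) \<Rightarrow> nat \<Rightarrow> 'a" where
  "tail t off m f a = t ^ (\<Sum>r\<in>{a..m}. nat (f (off + r - 1)))"

text \<open>The bounds \<open>off \<le> r\<close> keep \<open>i = 0\<close> and \<open>a \<le> 1\<close>, which stand for no factor, from touching
  the position before the block.\<close>
definition shift :: "nat \<Rightarrow> nat \<Rightarrow> nat \<Rightarrow> (nat \<Rightarrow> int) \<Rightarrow> nat \<Rightarrow> int" where
  "shift off i a f = (\<lambda>r. f r + of_bool (off \<le> r \<and> Suc r = off + i)
                              - of_bool (off \<le> r \<and> r + 2 = off + a))"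

definition tcoef2 ::
  "'a::comm_ring_1 \<Rightarrow> nat \<Rightarrow> nat \<Rightarrow> (nat \<Rightarrow> int) \<Rightarrow> nat \<Rightarrow> nat \<Rightarrow> nat \<Rightarrow> nat \<Rightarrow> 'a" where
  "tcoef2 t off m f i a j b =
     tcoef (tail t off m f) j b * tcoef (tail t off m (shift off j b f)) i a"

lemma tail_step:
  assumes "1 \<le> a" "a \<le> m"
  shows "tail t off m f a = t ^ nat (f (off + a - 1)) * tail t off m f (Suc a)"
  using assms by (simp add: tail_def sum.atLeast_Suc_atMost power_add)

text \<open>Undoes the telescoping of weights: in product form the coefficient visibly vanishes when
  the factor to be lowered is empty.\<close>

lemma tcoef_ge:
  assumes "Suc i < a" "a \<le> Suc m"
  shows "tcoef (tail t off m f) i a = tail t off m f a * (1 - t ^ nat (f (off + a - 2)))"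
proof -
  obtain c where "a = Suc (Suc c)" using assms by (cases a; cases "a - 1") auto
  then show ?thesis
    using assms tail_step[of "Suc c" m t off f] by (simp add: tcoef_def algebra_simps)
qed

text \<open>Lowering an empty factor carries the coefficient \<open>1 - t ^ 0 = 0\<close>. For
  \<open>a = Suc i\<close> raising and lowering hit the same position and cancel.\<close>

lemma shift_nonneg:
  assumes f: "\<forall>r<L. 0 \<le> f r" and L: "off + m \<le> L" and a: "a \<le> Suc m"
    and nz: "tcoef (tail t off m f) i a \<noteq> 0" and r: "r < L"
  shows "0 \<le> shift off i a f r"
proof (cases "off \<le> r \<and> r + 2 = off + a \<and> a \<noteq> Suc i")
  case True
  then have "Suc i < a"
    using nz by (cases "a \<le> i") (auto simp: tcoef_def)
  from tcoef_ge[OF this a, of t off f] nz have "f r \<noteq> 0"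
    using True by (metis (no_types, lifting) diff_add_inverse2 diff_self mult_zero_right nat_0 power_0)
  with f r have "1 \<le> f r" by force
  then show ?thesis by (simp add: shift_def)
next
  case False
  then show ?thesis using f r by (auto simp: shift_def)
qed

text \<open>Raising factor \<open>j\<close> adds one to the exponent exactly when
  \<open>a \<le> j\<close>; lowering factor \<open>b - 1\<close> removes one exactly when
  \<open>a < b\<close>, which becomes a division by \<open>t\<close>.\<close>

lemma tail_shift:
  fixes t :: "'a::field"
  assumes t: "t \<noteq> 0" and f: "\<forall>r<L. 0 \<le> f r" and sf: "\<forall>r<L. 0 \<le> shift off j b f r"
    and L: "off + m \<le> L" and a: "1 \<le> a" and "b \<le> Suc m" "j \<le> m"
  shows "tail t off m (shift off j b f) a = shift_tail t j b (tail t off m f) a"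
proof -
  let ?N = "\<lambda>f. \<Sum>r\<in>{a..m}. nat (f (off + r - 1))"
  \<comment> \<open>The count is made in the integers, where nonnegativity on both sides makes
    \<open>nat\<close> invisible and subtraction is not truncated.\<close>
  have "int (?N (shift off j b f)) = (\<Sum>r\<in>{a..m}. shift off j b f (off + r - 1))"
    unfolding of_nat_sum using sf L a by (intro sum.cong) auto
  also have "\<dots> = (\<Sum>r\<in>{a..m}. f (off + r - 1) + of_bool (r = j) - of_bool (Suc r = b))"
    using a by (intro sum.cong) (auto simp: shift_def)
  also have "\<dots> = (\<Sum>r\<in>{a..m}. f (off + r - 1)) + (\<Sum>r\<in>{a..m}. of_bool (r = j))
      - (\<Sum>r\<in>{a..m}. of_bool (Suc r = b))"
    by (simp add: sum.distrib sum_subtractf)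
  also have "(\<Sum>r\<in>{a..m}. f (off + r - 1)) = int (?N f)"
    unfolding of_nat_sum using f L a by (intro sum.cong) auto
  also have "(\<Sum>r\<in>{a..m}. of_bool (r = j)) = (of_bool (a \<le> j) :: int)"
    using \<open>j \<le> m\<close> by (simp add: of_bool_def sum.delta)
  also have "(\<Sum>r\<in>{a..m}. of_bool (Suc r = b)) = (of_bool (a < b) :: int)"
  proof (cases b)
    case (Suc b')
    then show ?thesis using \<open>b \<le> Suc m\<close> by (auto simp add: of_bool_def sum.delta)
  qed simp
  finally have "?N (shift off j b f) + of_bool (a < b) = ?N f + of_bool (a \<le> j)"
    by (cases "a < b"; cases "a \<le> j"; simp del: of_nat_sum)
  then have "t ^ (?N (shift off j b f) + of_bool (a < b)) = t ^ (?N f + of_bool (a \<le> j))"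
    by simp
  then show ?thesis
    using t by (auto simp: tail_def shift_tail_def power_add field_simps of_bool_def split: if_splits)
qed

text \<open>If the first coefficient is 0, both sides vanish; otherwise the shifted occupation
  numbers stay nonnegative and the weights follow \<open>tail_shift\<close>.\<close>

lemma tcoef2_shift_tail:
  fixes t :: "'a::field"
  assumes t: "t \<noteq> 0" and f: "\<forall>r<L. 0 \<le> f r"
    and L: "off + m \<le> L" and bj: "b \<le> Suc m" "j \<le> m"
  shows "tcoef2 t off m f i a j b =
     tcoef (tail t off m f) j b * tcoef (shift_tail t j b (tail t off m f)) i a"
proof (cases "tcoef (tail t off m f) j b = 0")
  case False
  then have sf: "\<forall>r<L. 0 \<le> shift off j b f r"
    using shift_nonneg[OF f L] bj by blast
  have "tail t off m (shift off j b f) c = shift_tail t j b (tail t off m f) c" if "1 \<le> c" for c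
    using tail_shift[OF t f sf L that] bj by blast
  then have "tcoef (tail t off m (shift off j b f)) i a = tcoef (shift_tail t j b (tail t off m f)) i a"
    by (auto simp: tcoef_def)
  then show ?thesis by (simp add: tcoef2_def)
qed (simp add: tcoef2_def)

lemma poly_tcoef2: "poly (tcoef2 [:0, 1:] off m f i a j b) u = tcoef2 u off m f i a j b"
  by (simp add: tcoef2_def tcoef_def tail_def poly_power)

text \<open>The defect evaluates its argument only at rows \<open>k\<close>, \<open>l\<close> and
  columns \<open>a\<close>, \<open>b\<close>, so agreement within the index bounds is
  enough.\<close>

lemma rtt_defect_cong:
  assumes "\<And>i j a' b'. i \<in> {k, l} \<Longrightarrow> j \<in> {k, l} \<Longrightarrow> a' \<in> {a, b} \<Longrightarrow> b' \<in> {a, b} \<Longrightarrow>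
    g i a' j b' = h i a' j b'"
  shows "rtt_defect t x y g k l a b = rtt_defect t x y h k l a b"
  using assms by (simp add: rtt_defect_def)

text \<open>For \<open>t = 0\<close> the shift rule fails, so this case is recovered from the others: the defect
  is a polynomial in \<open>t\<close>.\<close>
lemma rtt_defect_tcoef2:
  fixes t x y :: "'a::field_char_0"
  assumes f: "\<forall>r<L. 0 \<le> f r" and L: "off + m \<le> L"
    and bounds: "k \<le> m" "l \<le> m" "a \<le> Suc m" "b \<le> Suc m"
  shows "rtt_defect t x y (tcoef2 t off m f) k l a b = 0"
proof -
  define p where "p = rtt_defect [:0, 1:] [:x:] [:y:] (tcoef2 [:0, 1:] off m f) k l a b"
  have p: "poly p u = rtt_defect u x y (tcoef2 u off m f) k l a b" for u
    by (simp add: p_def rtt_defect_def zfac_def poly_tcoef2 algebra_simps)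
  have "poly p u = 0" if "u \<noteq> 0" for u
  proof -
    have "poly p u = rtt_defect u x y (\<lambda>i a j b. tcoef (tail u off m f) j b *
        tcoef (shift_tail u j b (tail u off m f)) i a) k l a b"
      unfolding p by (rule rtt_defect_cong, rule tcoef2_shift_tail[OF that f L]) (use bounds in auto)
    then show ?thesis by (simp add: rtt_defect_shift_tail[OF that])
  qed
  \<comment> \<open>In characteristic 0 these are infinitely many roots.\<close>
  then have "UNIV - {0} \<subseteq> {u. poly p u = 0}" by auto
  moreover have "infinite (UNIV - {0::'a})" by (simp add: infinite_UNIV_char_0)
  ultimately have "p = 0" using poly_roots_finite finite_subset by blast
  then show ?thesis using p[of t] by simp
qed

section \<open>Sums against the \<open>R\<close> matrix and the RTT relation\<close>

lemma Rm_sum_upper: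
  fixes t z :: "'a::field"
  assumes "k \<le> m" "l \<le> m"
  shows "(\<Sum>i\<le>m. \<Sum>j\<le>m. Rm t z j i k l * H i j) =
    (if k = l then H k k else Rm t z k l k l * H l k + Rm t z l k k l * H k l)"
proof (cases "k = l")
  case True
  have "(\<Sum>i\<le>m. \<Sum>j\<le>m. Rm t z j i k l * H i j) = (\<Sum>i\<le>m. \<Sum>j\<le>m. if j = k then (if i = k then H i j else 0) else 0)"
    using True by (intro sum.cong refl) (auto simp: Rm_def)
  then show ?thesis using True assms by (simp add: sum.delta)
next
  case False
  have "(\<Sum>i\<le>m. \<Sum>j\<le>m. Rm t z j i k l * H i j) =
    (\<Sum>i\<le>m. \<Sum>j\<le>m. (if j = k then (if i = l then Rm t z k l k l * H i j else 0) else 0)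
      + (if j = l then (if i = k then Rm t z l k k l * H i j else 0) else 0))"
    using False by (intro sum.cong refl) (auto simp: Rm_def)
  then show ?thesis using False assms by (simp add: sum.delta sum.distrib)
qed

lemma Rm_sum_lower:
  fixes t z :: "'a::field"
  assumes "a \<le> n" "b \<le> n"
  shows "(\<Sum>c\<le>n. \<Sum>d\<le>n. Rm t z b a c d * H c d) =
    (if a = b then H a a else Rm t z b a b a * H b a + Rm t z b a a b * H a b)"
proof (cases "a = b")
  case True
  have "(\<Sum>c\<le>n. \<Sum>d\<le>n. Rm t z b a c d * H c d) = (\<Sum>c\<le>n. \<Sum>d\<le>n. if d = a then (if c = a then H c d else 0) else 0)"
    using True by (intro sum.cong refl) (auto simp: Rm_def)
  then show ?thesis using True assms by (simp add: sum.delta)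
next
  case False
  have "(\<Sum>c\<le>n. \<Sum>d\<le>n. Rm t z b a c d * H c d) =
    (\<Sum>c\<le>n. \<Sum>d\<le>n. (if d = a then (if c = b then Rm t z b a b a * H c d else 0) else 0)
      + (if d = b then (if c = a then Rm t z b a a b * H c d else 0) else 0))"
    using False by (intro sum.cong refl) (auto simp: Rm_def)
  then show ?thesis using False assms by (simp add: sum.delta sum.distrib)
qed

text \<open>Multiplying numerator and denominator by \<open>x\<close> gives every entry off the case
  of equal indices the common denominator \<open>x - t * y\<close>.\<close>

lemma Rm_diag:
  fixes t x y :: "'a::field"
  assumes "x \<noteq> 0" "a \<noteq> b"
  shows "Rm t (y / x) a b a b = (x - y) * (if a < b then t else 1) / (x - t * y)"
  using assms by (simp add: Rm_def divide_simps)

lemma Rm_offdiag: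
  fixes t x y :: "'a::field"
  assumes "x \<noteq> 0" "a \<noteq> b"
  shows "Rm t (y / x) b a a b = (1 - t) * (if b < a then y else x) / (x - t * y)"
  using assms by (simp add: Rm_def divide_simps)

text \<open>Each double sum has at most two surviving terms. Over the common denominator
  \<open>x - t * y\<close>, the difference of the numerators is \<open>rtt_defect\<close>, which
  vanishes.\<close>

lemma RTT:
  fixes t x y :: "'a::field_char_0"
  assumes x: "x \<noteq> 0" and "1 - t * (y / x) \<noteq> 0"
    and f: "\<forall>r<L. 0 \<le> f r" and L: "off + m \<le> L"
    and bounds: "k \<le> m" "l \<le> m" "a \<le> Suc m" "b \<le> Suc m"
  shows "(\<Sum>i\<le>m. \<Sum>j\<le>m. Rm t (y / x) j i k l * (zfac a y * zfac b x * tcoef2 t off m f i a j b)) =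
    (\<Sum>c\<le>Suc m. \<Sum>d\<le>Suc m. Rm t (y / x) b a c d * (zfac c x * zfac d y * tcoef2 t off m f k c l d))"
proof -
  let ?D = "x - t * y"
  let ?H = "\<lambda>i a j b. zfac a y * zfac b x * tcoef2 t off m f i a j b"
  let ?K = "\<lambda>i a j b. zfac a x * zfac b y * tcoef2 t off m f i a j b"
  have nz: "?D \<noteq> 0" using assms(1,2) by (simp add: field_simps)
  have "(\<Sum>i\<le>m. \<Sum>j\<le>m. Rm t (y / x) j i k l * ?H i a j b) =
    (if k = l then ?D * ?H k a l b
     else (x - y) * (if k < l then t else 1) * ?H l a k b + (1 - t) * (if l < k then y else x) * ?H k a l b) / ?D"
    unfolding Rm_sum_upper[OF bounds(1,2)] using nz
    by (cases "k = l") (simp_all only: Rm_diag[OF x] Rm_offdiag[OF x] if_True if_False simp_thms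
        add_divide_distrib times_divide_eq_left nonzero_mult_div_cancel_left not_False_eq_True)
  also have "\<dots> = (if a = b then ?D * ?K k a l b
     else (x - y) * (if b < a then t else 1) * ?K k b l a + (1 - t) * (if b < a then y else x) * ?K k a l b) / ?D"
    using rtt_defect_tcoef2[OF f L bounds, where t=t and x=x and y=y]
    unfolding rtt_defect_def by simp
  also have "\<dots> = (\<Sum>c\<le>Suc m. \<Sum>d\<le>Suc m. Rm t (y / x) b a c d * ?K k c l d)"
    unfolding Rm_sum_lower[OF bounds(3,4)] using nz
    by (cases "a = b") (simp_all only: Rm_diag[OF x] Rm_offdiag[OF x] if_True if_False simp_thms
        add_divide_distrib times_divide_eq_left nonzero_mult_div_cancel_left not_False_eq_True not_sym)
  finally show ?thesis .
qed

subsection \<open>Local operators\<close>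

text \<open>Generating local operators from oscillators lets linearity and commutation be proved
  once, by induction, and then applied to both \<open>Top\<close> and \<open>Xop\<close>.\<close>

inductive local_op :: "'a::comm_ring_1 \<Rightarrow> nat set \<Rightarrow> ('a fvec \<Rightarrow> 'a fvec) \<Rightarrow> bool"
  for t :: "'a::comm_ring_1" and S :: "nat set" where
  id: "local_op t S id"
| zero: "local_op t S (\<lambda>v e. 0)"
| vsmul: "local_op t S (vsmul c)"
| aplus: "r \<in> S \<Longrightarrow> local_op t S (aplus r)"
| aminus: "r \<in> S \<Longrightarrow> local_op t S (aminus t r)"
| kop: "r \<in> S \<Longrightarrow> local_op t S (kop t r)"
| comp: "local_op t S P \<Longrightarrow> local_op t S Q \<Longrightarrow> local_op t S (P \<circ> Q)"
| add: "local_op t S P \<Longrightarrow> local_op t S Q \<Longrightarrow> local_op t S (\<lambda>v e. P v e + Q v e)"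

lemma local_op_mono: "local_op t S P \<Longrightarrow> S \<subseteq> S' \<Longrightarrow> local_op t S' P"
  by (induction rule: local_op.induct) (auto intro: local_op.intros)

lemma local_op_vsmul: "local_op t S P \<Longrightarrow> P (vsmul c v) = vsmul c (P v)"
proof (induction arbitrary: v rule: local_op.induct)
  case (add P Q)
  then show ?case by (simp add: vsmul_def algebra_simps)
qed (auto simp: vsmul_def aplus_def aminus_def kop_def mult_ac intro!: ext)

lemma local_op_add: "local_op t S P \<Longrightarrow> P (\<lambda>e. u e + v e) = (\<lambda>e. P u e + P v e)"
proof (induction arbitrary: u v rule: local_op.induct)
  case (comp P Q)
  then show ?case by simp
qed (auto simp: vsmul_def aplus_def aminus_def kop_def algebra_simps intro!: ext)

lemma local_op_zero: "local_op t S P \<Longrightarrow> P (\<lambda>e. 0) = (\<lambda>e. 0)"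
  using local_op_vsmul[of t S P 0 "\<lambda>e. 0"] by (simp add: vsmul_def)

lemma local_op_sum: "local_op t S P \<Longrightarrow> P (\<lambda>e. \<Sum>i<(k::nat). v i e) = (\<lambda>e. \<Sum>i<k. P (v i) e)"
  by (induction k) (simp_all add: local_op_zero local_op_add[of t S P])

lemma local_op_sum_op:
  "(\<And>i. i < k \<Longrightarrow> local_op t S (P i)) \<Longrightarrow> local_op t S (\<lambda>v e. \<Sum>i<(k::nat). P i v e)"
  by (induction k) (simp_all add: local_op.intros)

lemma oscillators_commute:
  assumes "r \<noteq> q"
  shows "aplus r (aplus q v) = aplus q (aplus r v)"
    "aplus r (aminus t q v) = aminus t q (aplus r v)"
    "aplus r (kop t q v) = kop t q (aplus r v)"
    "aminus t r (aminus t q v) = aminus t q (aminus t r v)"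
    "aminus t r (kop t q v) = kop t q (aminus t r v)"
    "kop t r (kop t q v) = kop t q (kop t r v)"
  using assms not_sym[OF assms]
  by (auto simp: aplus_def aminus_def kop_def list_update_swap[OF assms] mult_ac intro!: ext)

lemma local_op_commute:
  assumes "local_op t A P" and Q: "local_op t B Q" and disj: "A \<inter> B = {}"
  shows "P (Q v) = Q (P v)"
proof -
  note intros = local_op.aplus[of _ UNIV t] local_op.aminus[of _ UNIV t] local_op.kop[of _ UNIV t]
  note lin = intros[THEN local_op_vsmul] intros[THEN local_op_zero] intros[THEN local_op_add]
  \<comment> \<open>A single oscillator outside \<open>B\<close> is first moved past
    \<open>Q\<close> by induction on \<open>Q\<close>; induction on \<open>P\<close> then covers
    arbitrary products and sums.\<close>
  have "aplus r (Q v) = Q (aplus r v) \<and> aminus t r (Q v) = Q (aminus t r v) \<and> kop t r (Q v) = Q (kop t r v)"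
    if r: "r \<notin> B" for r v
    using Q
  proof (induction arbitrary: v rule: local_op.induct)
    case (aplus q)
    then have "r \<noteq> q" using r by auto
    then show ?case by (simp add: oscillators_commute)
  next
    case (aminus q)
    then have "r \<noteq> q" using r by auto
    then show ?case by (simp add: oscillators_commute)
  next
    case (kop q)
    then have "r \<noteq> q" using r by auto
    then show ?case by (simp add: oscillators_commute)
  qed (simp_all add: lin)
  note gen = this
  show ?thesis
    using assms(1)
  proof (induction arbitrary: v rule: local_op.induct)
    case (aplus r)
    then show ?case using gen disj by blast
  next
    case (aminus r)
    then show ?case using gen disj by blast
  next
    case (kop r)
    then show ?case using gen disj by blast
  qed (simp_all add: local_op_zero[OF Q] local_op_vsmul[OF Q] local_op_add[OF Q])
qed

lemma local_op_kprod:
  assumes "\<And>r. a \<le> r \<Longrightarrow> r < b \<Longrightarrow> off + r - 1 \<in> S"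
  shows "local_op t S (kprod t off a b)"
proof -
  have "local_op t S (foldr (\<lambda>r f. kop t (off + r - 1) \<circ> f) rs id)"
    if "\<forall>r\<in>set rs. off + r - 1 \<in> S" for rs
    using that by (induction rs) (simp_all add: local_op.intros)
  then show ?thesis using assms by (simp add: kprod_def)
qed

lemma local_op_Top:
  assumes "i \<le> m"  "a \<le> Suc m"
  shows "local_op t {off..<off + m} (Top t (Suc m) off i a z)"
proof -
  have pos: "local_op t {off..<off + m} (apos off i)"
  proof (cases "i = 0")
    case False
    then have "off + i - 1 \<in> {off..<off + m}" using assms by auto
    then show ?thesis using False by (simp add: apos_def local_op.aplus)
  qed (simp add: apos_def local_op.id)
  have k: "local_op t {off..<off + m} (kprod t off a (Suc m))" if "0 < a"
    using that by (intro local_op_kprod) auto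
  have am: "local_op t {off..<off + m} (aminus t (off + a - 2))" if "i + 2 \<le> a"
    using that assms by (intro local_op.intros) auto
  show ?thesis
    using pos k am by (auto simp: Top_def intro: local_op.intros)
qed

text \<open>The half-line \<open>{off..}\<close> replaces the exact block of factors: at offset
  \<open>off + m\<close> it is disjoint from the block of \<open>T\<close>, as commutation
  requires.\<close>

lemma local_op_Xop: "a \<le> n \<Longrightarrow> local_op t {off..} (Xop t n off a z)"
proof (induction n arbitrary: off a)
  case (Suc m)
  have "local_op t {off..} (Xop t m (off + m) i z \<circ> Top t (Suc m) off i a z)" if "i < Suc m" for i
    using that Suc.prems
    by (intro local_op.comp local_op_mono[OF Suc.IH] local_op_mono[OF local_op_Top]) auto
  then show ?case
    using local_op_sum_op[of "Suc m" t "{off..}" "\<lambda>i. Xop t m (off + m) i z \<circ> Top t (Suc m) off i a z"]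
    by (simp del: sum.lessThan_Suc)
qed (auto intro: local_op.intros)

subsection \<open>The action on basis vectors\<close>

text \<open>Integer occupation numbers make the shifts caused by \<open>T\<close> commute; a vector with a negative
  occupation number is \<open>0\<close>.\<close>
definition ket :: "nat \<Rightarrow> (nat \<Rightarrow> int) \<Rightarrow> 'a::zero_neq_one fvec" where
  "ket L f = (\<lambda>e. if length e = L \<and> (\<forall>r<L. int (e ! r) = f r) then 1 else 0)"

lemma basis_eq_ket: "basis d = ket (length d) (\<lambda>r. int (d ! r))"
  by (auto simp: basis_def ket_def fun_eq_iff intro: nth_equalityI)

lemma ket_cong: "(\<And>r. r < L \<Longrightarrow> f r = g r) \<Longrightarrow> ket L f = ket L g"
  by (simp add: ket_def)

lemma ket_neg:
  assumes "r < L" "f r < 0"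
  shows "ket L f = (\<lambda>e. 0)"
proof (rule ext)
  fix e
  have "\<not> (\<forall>r<L. int (e ! r) = f r)"
    using assms by (metis not_less of_nat_0_le_iff)
  then show "ket L f e = 0" by (auto simp: ket_def)
qed

text \<open>Separates the condition at \<open>r\<close> from those at the other positions, which an
  oscillator at \<open>r\<close> leaves alone.\<close>

lemma ket_update:
  assumes "r < L" "length e = L"
  shows "ket L f (e[r := q]) = (if int q = f r \<and> (\<forall>p<L. p \<noteq> r \<longrightarrow> int (e ! p) = f p) then 1 else 0)"
proof -
  have "(\<forall>p<L. int (e[r := q] ! p) = f p) \<longleftrightarrow>
      int q = f r \<and> (\<forall>p<L. p \<noteq> r \<longrightarrow> int (e ! p) = f p)"
    using assms by (auto simp: nth_list_update)
  then show ?thesis using assms by (simp add: ket_def)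
qed

lemma ket_at:
  assumes "r < L" "length e = L"
  shows "ket L f e = (if int (e ! r) = f r \<and> (\<forall>p<L. p \<noteq> r \<longrightarrow> int (e ! p) = f p) then 1 else 0)"
  using ket_update[OF assms, of f "e ! r"] by simp

lemma ket_length: "length e \<noteq> L \<Longrightarrow> ket L f e = 0"
  by (simp add: ket_def)

text \<open>The sign condition excludes \<open>f r = -1\<close>, where the left side is 0 while the
  right side has occupation number 0 at \<open>r\<close>.\<close>

lemma aplus_ket:
  assumes "r < L" "0 \<le> f r"
  shows "aplus r (ket L f) = ket L (f(r := f r + 1))"
proof (rule ext)
  fix e
  show "aplus r (ket L f) e = ket L (f(r := f r + 1)) e"
  proof (cases "length e = L")
    case True
    with assms show ?thesis
      by (cases "e ! r") (simp_all add: aplus_def ket_update ket_at[OF assms(1) True])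
  qed (simp add: aplus_def ket_length)
qed

text \<open>For \<open>f r \<le> 0\<close> both sides vanish, because \<open>nat (f r) = 0\<close>
  makes the coefficient 0.\<close>

lemma aminus_ket:
  assumes "r < L"
  shows "aminus t r (ket L f) = vsmul (1 - t ^ nat (f r)) (ket L (f(r := f r - 1)))"
proof (rule ext)
  fix e
  show "aminus t r (ket L f) e = vsmul (1 - t ^ nat (f r)) (ket L (f(r := f r - 1))) e"
  proof (cases "length e = L")
    case True
    have "nat (f r) = Suc (e ! r)" if "int (Suc (e ! r)) = f r"
      using that by linarith
    with assms True show ?thesis
      by (cases "int (Suc (e ! r)) = f r")
        (simp_all add: aminus_def vsmul_def ket_update ket_at[OF assms True])
  qed (simp add: aminus_def vsmul_def ket_length)
qed

lemma kop_ket: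
  assumes "r < L"
  shows "kop t r (ket L f) = vsmul (t ^ nat (f r)) (ket L f)"
proof (rule ext)
  fix e
  show "kop t r (ket L f) e = vsmul (t ^ nat (f r)) (ket L f) e"
  proof (cases "length e = L")
    case True
    show ?thesis
    proof (cases "int (e ! r) = f r")
      case True
      then have "nat (f r) = e ! r" by linarith
      then show ?thesis by (simp add: kop_def vsmul_def)
    qed (simp add: kop_def vsmul_def ket_at[OF assms True])
  qed (simp add: kop_def vsmul_def ket_length)
qed

lemma vsmul_vsmul: "vsmul c (vsmul d v) = vsmul (c * d :: 'a::semigroup_mult) v"
  by (simp add: vsmul_def mult.assoc)

lemma kprod_ket:
  assumes "off + m \<le> L" "1 \<le> a"
  shows "kprod t off a (Suc m) (ket L f) = vsmul (tail t off m f a) (ket L f)"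
proof -
  have "foldr (\<lambda>r f. kop t (off + r - 1) \<circ> f) rs id (ket L f) =
      vsmul (t ^ (\<Sum>r\<leftarrow>rs. nat (f (off + r - 1)))) (ket L f)"
    if "\<forall>r\<in>set rs. off + r - 1 < L" for rs
    using that
  proof (induction rs)
    case (Cons r rs)
    have "kop t (off + r - 1) (vsmul c (ket L f)) = vsmul c (kop t (off + r - 1) (ket L f))" for c
      by (rule local_op_vsmul[OF local_op.kop[of _ UNIV]]) simp
    with Cons show ?case by (simp add: kop_ket vsmul_vsmul power_add mult.commute)
  qed (simp add: vsmul_def)
  note foldr_ket = this
  have "\<forall>r\<in>set [a..<Suc m]. off + r - 1 < L"
    using assms by auto
  from foldr_ket[OF this] show ?thesis
    by (simp add: kprod_def tail_def sum_list_distinct_conv_sum_set atLeastLessThanSuc_atLeastAtMost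
        del: upt_Suc)
qed

lemma Top_ket:
  assumes f: "\<forall>r<L. 0 \<le> f r" and L: "off + m \<le> L" and bounds: "i \<le> m" "a \<le> Suc m"
  shows "Top (t :: 'a::comm_ring_1) (Suc m) off i a z (ket L f) =
    vsmul (zfac a z * tcoef (tail t off m f) i a) (ket L (shift off i a f))"
proof -
  have pos: "apos off i (ket L g) = ket L (\<lambda>r. g r + of_bool (off \<le> r \<and> Suc r = off + i))"
    if "0 < i \<Longrightarrow> 0 \<le> g (off + i - 1)" for g
  proof (cases "i = 0")
    case False
    then have "apos off i (ket L g) = ket L (g(off + i - 1 := g (off + i - 1) + 1))"
      using that bounds L by (simp add: apos_def aplus_ket)
    also have "\<dots> = ket L (\<lambda>r. g r + of_bool (off \<le> r \<and> Suc r = off + i))"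
      using False by (intro ket_cong) auto
    finally show ?thesis .
  qed (auto simp: apos_def intro!: ket_cong)
  have lin: "apos off i (vsmul c v) = vsmul c (apos off i v)"
    "aminus t q (vsmul c v) = vsmul c (aminus t q v)" for c q and v :: "'a fvec"
    by (auto simp: apos_def aplus_def aminus_def vsmul_def fun_eq_iff)
  consider "a = 0" | "a \<noteq> 0" "a \<le> i" | "a = Suc i" | "Suc i < a" by linarith
  then show ?thesis
  proof cases
    case 1
    then show ?thesis
      using f bounds L by (auto simp: Top_def pos zfac_def tcoef_def vsmul_def shift_def intro!: ket_cong)
  next
    case 2
    then show ?thesis by (simp add: Top_def tcoef_def vsmul_def)
  next
    case 3
    \<comment> \<open>The raised and lowered positions coincide, or for \<open>i = 0\<close> are
      both absent, in accordance with \<open>T\<close> containing only \<open>k\<close>'s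
      here.\<close>
    have "ket L (shift off i a f) = (ket L f :: 'a fvec)"
      using 3 by (intro ket_cong) (auto simp: shift_def)
    with 3 show ?thesis
      using kprod_ket[OF L, of a t f] by (simp add: Top_def tcoef_def zfac_def vsmul_vsmul)
  next
    case 4
    \<comment> \<open>Since \<open>Suc i < a\<close>, lowering does not touch the position that is
      raised next, so its occupation number is still nonnegative.\<close>
    have "ket L (shift off i a f) = (apos off i (ket L (f(off + a - 2 := f (off + a - 2) - 1))) :: 'a fvec)"
      using 4 f L bounds by (subst pos) (auto simp: shift_def intro!: ket_cong)
    with 4 show ?thesis
      using kprod_ket[OF L, of a t f] tcoef_ge[OF 4 bounds(2), of t off f] L bounds
      by (simp add: Top_def zfac_def vsmul_vsmul lin aminus_ket)
  qed
qed

lemma Top_Top_ket: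
  assumes f: "\<forall>r<L. 0 \<le> f r" and L: "off + m \<le> L"
    and bounds: "i \<le> m" "a \<le> Suc m" "j \<le> m" "b \<le> Suc m"
  shows "Top t (Suc m) off i a y (Top t (Suc m) off j b x (ket L f)) =
    vsmul (zfac a y * zfac b x * tcoef2 t off m f i a j b) (ket L (shift off i a (shift off j b f)))"
proof -
  note T = local_op_vsmul[OF local_op_Top[OF bounds(1,2)]]
  have "Top t (Suc m) off i a y (Top t (Suc m) off j b x (ket L f)) =
    vsmul (zfac b x * tcoef (tail t off m f) j b) (Top t (Suc m) off i a y (ket L (shift off j b f)))"
    by (simp add: Top_ket[OF f L bounds(3,4)] T)
  also have "\<dots> = vsmul (zfac a y * zfac b x * tcoef2 t off m f i a j b)
      (ket L (shift off i a (shift off j b f)))"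
  \<comment> \<open>The shifted vector may have a negative occupation number only if the first
    coefficient is 0, and then both sides vanish.\<close>
  proof (cases "tcoef (tail t off m f) j b = 0")
    case False
    then have "\<forall>r<L. 0 \<le> shift off j b f r"
      using shift_nonneg[OF f L bounds(4)] by blast
    from Top_ket[OF this L bounds(1,2), of t y] show ?thesis
      by (simp add: vsmul_vsmul tcoef2_def mult_ac)
  qed (simp add: tcoef2_def vsmul_def)
  finally show ?thesis .
qed

text \<open>The second \<open>T\<close> is moved past the inner \<open>X\<close>, which acts on
  later factors, so that the two \<open>T\<close>'s meet on the ket.\<close>

lemma Xop_Xop_ket:
  assumes f: "\<forall>r<L. 0 \<le> f r" and L: "off + m \<le> L" and bounds: "a \<le> Suc m" "b \<le> Suc m"
  shows "Xop t (Suc m) off a y (Xop t (Suc m) off b x (ket L f)) e =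
    (\<Sum>i\<le>m. \<Sum>j\<le>m. (zfac a y * zfac b x * tcoef2 t off m f i a j b) *
      Xop t m (off + m) i y (Xop t m (off + m) j x (ket L (shift off i a (shift off j b f)))) e)"
proof -
  let ?X = "\<lambda>i z. Xop t m (off + m) i z"
  let ?T = "\<lambda>i a z. Top t (Suc m) off i a z"
  have "Xop t (Suc m) off a y (Xop t (Suc m) off b x (ket L f)) e =
      (\<Sum>i<Suc m. ?X i y (?T i a y (\<lambda>e. \<Sum>j<Suc m. ?X j x (?T j b x (ket L f)) e)) e)"
    by (simp del: sum.lessThan_Suc)
  also have "\<dots> = (\<Sum>i<Suc m. \<Sum>j<Suc m. ?X i y (?X j x (?T i a y (?T j b x (ket L f)))) e)"
  proof (rule sum.cong[OF refl])
    fix i assume "i \<in> {..<Suc m}"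
    then have i: "i \<le> m" by simp
    have "?X i y (?T i a y (\<lambda>e. \<Sum>j<Suc m. ?X j x (?T j b x (ket L f)) e)) e =
        (\<Sum>j<Suc m. ?X i y (?T i a y (?X j x (?T j b x (ket L f)))) e)"
      by (simp only: local_op_sum[OF local_op_Top[OF i bounds(1)]] local_op_sum[OF local_op_Xop[OF i]])
    also have "\<dots> = (\<Sum>j<Suc m. ?X i y (?X j x (?T i a y (?T j b x (ket L f)))) e)"
    proof (rule sum.cong[OF refl])
      fix j assume "j \<in> {..<Suc m}"
      then have j: "j \<le> m" by simp
      show "?X i y (?T i a y (?X j x (?T j b x (ket L f)))) e =
          ?X i y (?X j x (?T i a y (?T j b x (ket L f)))) e"
        by (subst local_op_commute[OF local_op_Top[OF i bounds(1)] local_op_Xop[OF j]]) auto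
    qed
    finally show "?X i y (?T i a y (\<lambda>e. \<Sum>j<Suc m. ?X j x (?T j b x (ket L f)) e)) e =
      (\<Sum>j<Suc m. ?X i y (?X j x (?T i a y (?T j b x (ket L f)))) e)" .
  qed
  also have "\<dots> = (\<Sum>i\<le>m. \<Sum>j\<le>m. (zfac a y * zfac b x * tcoef2 t off m f i a j b) *
      ?X i y (?X j x (ket L (shift off i a (shift off j b f)))) e)"
    unfolding lessThan_Suc_atMost
  proof (intro sum.cong refl)
    fix i j assume "i \<in> {..m}" "j \<in> {..m}"
    then have i: "i \<le> m" and j: "j \<le> m" by auto
    show "?X i y (?X j x (?T i a y (?T j b x (ket L f)))) e =
      (zfac a y * zfac b x * tcoef2 t off m f i a j b) *
        ?X i y (?X j x (ket L (shift off i a (shift off j b f)))) e"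
      unfolding Top_Top_ket[OF f L i bounds(1) j bounds(2)]
        local_op_vsmul[OF local_op_Xop[OF i]] local_op_vsmul[OF local_op_Xop[OF j]]
      by (simp add: vsmul_def)
  qed
  finally show ?thesis .
qed

section \<open>The exchange relation by induction on \<open>n\<close>\<close>

lemma Rm_nonzeroD: "Rm t z c d a b \<noteq> 0 \<Longrightarrow> c = a \<and> d = b \<or> c = b \<and> d = a"
  unfolding Rm_def by metis

text \<open>Integer shifts add, so a double shift depends only on the multiset of raised indices and
  on that of lowered indices. A nonzero entry of \<open>R\<close> preserves both.\<close>

lemma shift_shift_Rm:
  shows "Rm t z j i k l \<noteq> 0 \<Longrightarrow>
      shift off i a (shift off j b f) = shift off k a (shift off l b f)"
    and "Rm t z b a c d \<noteq> 0 \<Longrightarrow>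
      shift off i a (shift off j b f) = shift off i c (shift off j d f)"
  by (drule Rm_nonzeroD, elim disjE conjE, simp_all add: shift_def fun_eq_iff)+

lemma sum_swap_pairs:
  "(\<Sum>i\<in>A. \<Sum>j\<in>B. \<Sum>k\<in>C. \<Sum>l\<in>D. F i j k l) = (\<Sum>k\<in>C. \<Sum>l\<in>D. \<Sum>i\<in>A. \<Sum>j\<in>B. F i j k l)"
proof -
  have "(\<Sum>i\<in>A. \<Sum>j\<in>B. \<Sum>k\<in>C. \<Sum>l\<in>D. F i j k l) = (\<Sum>i\<in>A. \<Sum>k\<in>C. \<Sum>j\<in>B. \<Sum>l\<in>D. F i j k l)"
    by (rule sum.cong[OF refl], rule sum.swap)
  also have "\<dots> = (\<Sum>k\<in>C. \<Sum>i\<in>A. \<Sum>j\<in>B. \<Sum>l\<in>D. F i j k l)"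
    by (rule sum.swap)
  also have "\<dots> = (\<Sum>k\<in>C. \<Sum>i\<in>A. \<Sum>l\<in>D. \<Sum>j\<in>B. F i j k l)"
    by (rule sum.cong[OF refl], rule sum.cong[OF refl], rule sum.swap)
  also have "\<dots> = (\<Sum>k\<in>C. \<Sum>l\<in>D. \<Sum>i\<in>A. \<Sum>j\<in>B. F i j k l)"
    by (rule sum.cong[OF refl], rule sum.swap)
  finally show ?thesis .
qed

text \<open>The total length \<open>L\<close> stays fixed while the offset moves. Allowing every
  integer-valued \<open>f\<close> makes the induction hypothesis applicable to all shifted kets
  without checking signs.\<close>

lemma Xop_exchange_ket:
  fixes t x y :: "'a::field_char_0"
  assumes x: "x \<noteq> 0" and nz: "1 - t * (y / x) \<noteq> 0"
  shows "off + n * (n - 1) div 2 \<le> L \<Longrightarrow> a \<le> n \<Longrightarrow> b \<le> n \<Longrightarrow>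
    Xop t n off a y (Xop t n off b x (ket L f)) e =
    (\<Sum>c\<le>n. \<Sum>d\<le>n. Rm t (y / x) b a c d * Xop t n off c x (Xop t n off d y (ket L f)) e)"
proof (induction n arbitrary: off a b f)
  case 0
  then show ?case by (simp add: Rm_def)
next
  case (Suc m)
  let ?X = "\<lambda>i z. Xop t m (off + m) i z"
  let ?R = "Rm t (y / x)"
  have "Suc m * (Suc m - 1) = m * (m - 1) + m * 2"
    by (cases m) (simp_all add: algebra_simps)
  \<comment> \<open>The triangular number grows by \<open>m\<close>, the number of factors on which
    \<open>T\<close> acts.\<close>
  then have half: "Suc m * (Suc m - 1) div 2 = m * (m - 1) div 2 + m"
    by (simp only: div_mult_self1 add.commute zero_neq_numeral not_False_eq_True)
  with Suc.prems have L: "off + m \<le> L" "off + m + m * (m - 1) div 2 \<le> L"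
    by linarith+
  show ?case
  proof (cases "\<forall>r<L. 0 \<le> f r")
    case False
    then obtain r where "r < L" "f r < 0" by (auto simp: not_le)
    then have "ket L f = (\<lambda>e. 0 :: 'a)" by (rule ket_neg)
    moreover have "Xop t (Suc m) off c z (\<lambda>e. 0) = (\<lambda>e. 0)" if "c \<le> Suc m" for c z
      by (rule local_op_zero[OF local_op_Xop[OF that]])
    ultimately show ?thesis
      using Suc.prems(2,3) by (simp del: Xop.simps sum.atMost_Suc)
  next
    case True
    then have f: "\<forall>r<L. 0 \<le> f r" by blast
    let ?F = "\<lambda>i a j b. shift off i a (shift off j b f)"
    let ?g = "\<lambda>i a j b. tcoef2 t off m f i a j b"
    let ?Z = "\<lambda>k l F. ?X k x (?X l y (ket L F)) e"
    have "Xop t (Suc m) off a y (Xop t (Suc m) off b x (ket L f)) e =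
      (\<Sum>i\<le>m. \<Sum>j\<le>m. (zfac a y * zfac b x * ?g i a j b) * ?X i y (?X j x (ket L (?F i a j b))) e)"
      by (rule Xop_Xop_ket[OF True L(1) Suc.prems(2,3)])
    also have "\<dots> = (\<Sum>i\<le>m. \<Sum>j\<le>m. (zfac a y * zfac b x * ?g i a j b) *
        (\<Sum>k\<le>m. \<Sum>l\<le>m. ?R j i k l * ?Z k l (?F i a j b)))"
    proof (rule sum.cong[OF refl], rule sum.cong[OF refl])
      fix i j assume "i \<in> {..m}" "j \<in> {..m}"
      then have "?X i y (?X j x (ket L (?F i a j b))) e = (\<Sum>k\<le>m. \<Sum>l\<le>m. ?R j i k l * ?Z k l (?F i a j b))"
        by (intro Suc.IH[OF L(2)]) auto
      then show "(zfac a y * zfac b x * ?g i a j b) * ?X i y (?X j x (ket L (?F i a j b))) e =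
          (zfac a y * zfac b x * ?g i a j b) * (\<Sum>k\<le>m. \<Sum>l\<le>m. ?R j i k l * ?Z k l (?F i a j b))"
        by (rule arg_cong)
    qed
    \<comment> \<open>Where \<open>R\<close> is nonzero the ket depends on \<open>k\<close>,
      \<open>l\<close> instead of \<open>i\<close>, \<open>j\<close>; the sum over \<open>i\<close>,
      \<open>j\<close> can then be isolated as one side of \<open>RTT\<close>.\<close>
    also have "\<dots> = (\<Sum>i\<le>m. \<Sum>j\<le>m. \<Sum>k\<le>m. \<Sum>l\<le>m.
        ?R j i k l * (zfac a y * zfac b x * ?g i a j b) * ?Z k l (?F k a l b))"
      unfolding sum_distrib_left
    proof (intro sum.cong refl)
      fix i j k l
      show "zfac a y * zfac b x * ?g i a j b * (?R j i k l * ?Z k l (?F i a j b)) =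
        ?R j i k l * (zfac a y * zfac b x * ?g i a j b) * ?Z k l (?F k a l b)"
      proof (cases "?R j i k l = 0")
        case False
        then have "?F i a j b = ?F k a l b"
          by (rule shift_shift_Rm(1))
        then show ?thesis by simp
      qed simp
    qed
    also have "\<dots> = (\<Sum>k\<le>m. \<Sum>l\<le>m. \<Sum>i\<le>m. \<Sum>j\<le>m.
        ?R j i k l * (zfac a y * zfac b x * ?g i a j b) * ?Z k l (?F k a l b))"
      by (rule sum_swap_pairs)
    also have "\<dots> = (\<Sum>k\<le>m. \<Sum>l\<le>m.
        (\<Sum>i\<le>m. \<Sum>j\<le>m. ?R j i k l * (zfac a y * zfac b x * ?g i a j b)) * ?Z k l (?F k a l b))"
      by (simp only: sum_distrib_right)
    also have "\<dots> = (\<Sum>k\<le>m. \<Sum>l\<le>m.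
        (\<Sum>c\<le>Suc m. \<Sum>d\<le>Suc m. ?R b a c d * (zfac c x * zfac d y * ?g k c l d)) * ?Z k l (?F k a l b))"
    proof (rule sum.cong[OF refl], rule sum.cong[OF refl])
      fix k l assume "k \<in> {..m}" "l \<in> {..m}"
      then have k: "k \<le> m" and l: "l \<le> m" by auto
      show "(\<Sum>i\<le>m. \<Sum>j\<le>m. ?R j i k l * (zfac a y * zfac b x * ?g i a j b)) * ?Z k l (?F k a l b) =
        (\<Sum>c\<le>Suc m. \<Sum>d\<le>Suc m. ?R b a c d * (zfac c x * zfac d y * ?g k c l d)) * ?Z k l (?F k a l b)"
        by (simp only: RTT[OF x nz True L(1) k l Suc.prems(2,3)])
    qed
    also have "\<dots> = (\<Sum>k\<le>m. \<Sum>l\<le>m. \<Sum>c\<le>Suc m. \<Sum>d\<le>Suc m.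
        ?R b a c d * (zfac c x * zfac d y * ?g k c l d) * ?Z k l (?F k a l b))"
      by (simp only: sum_distrib_right)
    \<comment> \<open>The same invariance, now in the columns, restores the ket that belongs to
      \<open>c\<close>, \<open>d\<close>, so that the \<open>X\<close>'s of rank
      \<open>Suc m\<close> can be reassembled.\<close>
    also have "\<dots> = (\<Sum>k\<le>m. \<Sum>l\<le>m. \<Sum>c\<le>Suc m. \<Sum>d\<le>Suc m.
        ?R b a c d * (zfac c x * zfac d y * ?g k c l d * ?Z k l (?F k c l d)))"
    proof (intro sum.cong refl)
      fix k l c d
      show "?R b a c d * (zfac c x * zfac d y * ?g k c l d) * ?Z k l (?F k a l b) =
        ?R b a c d * (zfac c x * zfac d y * ?g k c l d * ?Z k l (?F k c l d))"
      proof (cases "?R b a c d = 0")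
        case False
        then have "?F k a l b = ?F k c l d"
          by (rule shift_shift_Rm(2))
        then show ?thesis by simp
      qed simp
    qed
    also have "\<dots> = (\<Sum>c\<le>Suc m. \<Sum>d\<le>Suc m. \<Sum>k\<le>m. \<Sum>l\<le>m.
        ?R b a c d * (zfac c x * zfac d y * ?g k c l d * ?Z k l (?F k c l d)))"
      by (rule sum_swap_pairs)
    also have "\<dots> = (\<Sum>c\<le>Suc m. \<Sum>d\<le>Suc m.
        ?R b a c d * Xop t (Suc m) off c x (Xop t (Suc m) off d y (ket L f)) e)"
    proof (rule sum.cong[OF refl], rule sum.cong[OF refl])
      fix c d assume "c \<in> {..Suc m}" "d \<in> {..Suc m}"
      then have c: "c \<le> Suc m" and d: "d \<le> Suc m" by auto
      show "(\<Sum>k\<le>m. \<Sum>l\<le>m. ?R b a c d * (zfac c x * zfac d y * ?g k c l d * ?Z k l (?F k c l d))) =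
        ?R b a c d * Xop t (Suc m) off c x (Xop t (Suc m) off d y (ket L f)) e"
        by (simp only: Xop_Xop_ket[OF True L(1) c d] sum_distrib_left)
    qed
    finally show ?thesis .
  qed
qed

theorem theorem5p4:
  fixes t x y :: "'a::field_char_0" and n \<alpha> \<beta> :: nat and d :: "nat list"
  assumes "\<alpha> \<le> n" and "\<beta> \<le> n"
    and "x \<noteq> 0" and "1 - t * (y / x) \<noteq> 0"
    and "length d = n * (n - 1) div 2"
  shows "Xop t n 0 \<alpha> y (Xop t n 0 \<beta> x (basis d)) =
         (\<lambda>e. \<Sum>\<gamma>\<le>n. \<Sum>\<delta>\<le>n. Rm t (y / x) \<beta> \<alpha> \<gamma> \<delta> * Xop t n 0 \<gamma> x (Xop t n 0 \<delta> y (basis d)) e)"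
  unfolding basis_eq_ket
  by (rule ext, rule Xop_exchange_ket) (use assms in auto)

end
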